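(* Let $p$ be an odd prime and let $\mathcal B(\mathcal G(p))=\{\beta_k:k\in\mathbb Z_p\}\cup\{\beta_{a,b}:a,b\in\mathbb Z_p\}$, where $\beta_k=\{(k,\kappa):\kappa\in\mathbb Z_p\}$ and $\beta_{a,b}=\{(k,ak+b):k\in\mathbb Z_p\}$. Define $\eta^{(\beta)}\in\mathbb C^p$ (coordinates indexed by $j\in\mathbb Z_p$) by $\eta^{(\beta_k)}_j=\delta_{k+(p-1)/2,\,j}$ and $\eta^{(\beta_{a,b})}_j=\frac1{\sqrt p}\zeta^{\frac{p+1}2 j(aj+2b+a)}$. Then $\{\eta^{(\beta)}\}_{\beta\in\mathcal B(\mathcal G(p))}$ is a maximal set of mutually unbiased bases of $\mathbb C^p$, in which each parallel class ($\{\beta_k\}_{k\in\mathbb Z_p}$, and $\{\beta_{a,b}\}_{b\in\mathbb Z_p}$ for each fixed $a$) corresponds to the vectors of one orthonormal basis. Furthermore, for each $\beta$, $$\mathrm{span}\,\eta^{(\beta)}=\Big(\mathrm{span}\{M^\kappa T^k\phi_i:(k,\kappa)\in\beta,\ i\in\{0,\dots,(p-3)/2\}\}\Big)^\perp.$$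
   Context: Fix a primitive $p$-th root of unity $\zeta$ (the one used to build $\mathcal G(p)$). On $\mathbb C^p$ with standard basis $\{e_j\}_{j\in\mathbb Z_p}$, $Te_j=e_{j+1}$ and $Me_j=\zeta^je_j$. For $i\in\{0,\dots,(p-3)/2\}$, $\phi_i=e_i-e_{p-1-i}$; $\psi$ is the concatenation $\phi_0\oplus\cdots\oplus\phi_{(p-3)/2}$, $\pi(k,\kappa)=I_{(p-1)/2}\otimes(M^\kappa T^k)$, and $\mathcal G(p)=\{\pi(k,\kappa)\psi\}_{(k,\kappa)\in\mathbb Z_p^2}$; its binder (set of simplices) is the set of sets $\beta_k,\beta_{a,b}$ listed in the claim. In exponents, $\frac{p+1}{2}$ is the inverse of $2$ modulo $p$. A maximal set of mutually unbiased bases of $\mathbb C^p$ consists of $p+1$ orthonormal bases such that any two vectors $\eta,\eta'$ from different bases satisfy $|\langle\eta,\eta'\rangle|=1/\sqrt p$. *)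

theory Defs
  imports "HOL-Analysis.Analysis" "Berlekamp_Zassenhaus.Finite_Field"
begin

text \<open>
  Throughout, \<open>p = CARD('p)\<close>, and \<open>'p mod_ring\<close> is the ring of residues modulo \<open>p\<close>.
  The sort \<open>'p :: prime_card\<close> states that \<open>p\<close> is prime. Vectors of \<open>complex ^ 'p mod_ring\<close>
  have their coordinates indexed by the residues modulo \<open>p\<close>; the standard basis vector
  \<open>e\<^sub>j\<close> is \<open>axis j 1\<close>.
\<close>

definition primitive_root_of_unity :: "nat \<Rightarrow> complex \<Rightarrow> bool" where
  "primitive_root_of_unity n \<zeta> \<longleftrightarrow> \<zeta> ^ n = 1 \<and> (\<forall>m. 0 < m \<and> m < n \<longrightarrow> \<zeta> ^ m \<noteq> 1)"

text \<open>The representative of a residue in \<open>{0..<p}\<close>. It serves as exponent for \<open>\<zeta>\<close>, \<open>T\<close> and \<open>M\<close>,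
  all of which have order dividing \<open>p\<close>, so the choice of representative is immaterial.\<close>

definition residue_nat :: "'p::finite mod_ring \<Rightarrow> nat" where
  "residue_nat j = nat (to_int_mod_ring j)"

abbreviation root_pow :: "complex \<Rightarrow> 'p::finite mod_ring \<Rightarrow> complex" where
  "root_pow \<zeta> j \<equiv> \<zeta> ^ residue_nat j"


subsection \<open>Hermitian geometry of \<open>complex ^ 'n\<close>\<close>

text \<open>The inner product of \<^class>\<open>real_inner\<close> on \<open>complex ^ 'n\<close> is only the real part of this one.\<close>

definition cinner :: "complex ^ 'n::finite \<Rightarrow> complex ^ 'n \<Rightarrow> complex" where
  "cinner u v = (\<Sum>j\<in>UNIV. cnj (u $ j) * v $ j)"

definition ccomplement :: "(complex ^ 'n::finite) set \<Rightarrow> (complex ^ 'n) set" where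
  "ccomplement S = {v. \<forall>u\<in>S. cinner u v = 0}"

definition orthonormal_basis :: "(complex ^ 'n::finite) set \<Rightarrow> bool" where
  "orthonormal_basis B \<longleftrightarrow>
     (\<forall>u\<in>B. \<forall>v\<in>B. cinner u v = (if u = v then 1 else 0)) \<and>
     vec.independent B \<and> vec.span B = UNIV"

definition maximal_mubs :: "(complex ^ 'n::finite) set set \<Rightarrow> bool" where
  "maximal_mubs \<B> \<longleftrightarrow>
     card \<B> = CARD('n) + 1 \<and>
     (\<forall>B\<in>\<B>. orthonormal_basis B) \<and>
     (\<forall>B\<in>\<B>. \<forall>C\<in>\<B>. B \<noteq> C \<longrightarrow>
        (\<forall>u\<in>B. \<forall>v\<in>C. cmod (cinner u v) = 1 / sqrt (real CARD('n))))"


subsection \<open>The operators \<open>T\<close>, \<open>M\<close> and the vectors \<open>\<phi>\<^sub>i\<close>\<close>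

definition translation :: "complex ^ 'p::prime_card mod_ring \<Rightarrow> complex ^ 'p mod_ring" where
  "translation v = (\<chi> j. v $ (j - 1))"

definition modulation ::
    "complex \<Rightarrow> complex ^ 'p::prime_card mod_ring \<Rightarrow> complex ^ 'p mod_ring" where
  "modulation \<zeta> v = (\<chi> j. root_pow \<zeta> j * v $ j)"

lemma translation_axis: "translation (axis j 1) = axis (j + 1) 1"
  by (simp add: translation_def axis_def vec_eq_iff diff_eq_eq)

lemma modulation_axis: "modulation \<zeta> (axis j 1) = root_pow \<zeta> j *s axis j 1"
  by (simp add: modulation_def axis_def vec_eq_iff)

definition time_freq_shift ::
    "complex \<Rightarrow> 'p mod_ring \<times> 'p mod_ring \<Rightarrow>
     complex ^ 'p::prime_card mod_ring \<Rightarrow> complex ^ 'p mod_ring" where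
  "time_freq_shift \<zeta> = (\<lambda>(k, \<kappa>). (modulation \<zeta> ^^ residue_nat \<kappa>) \<circ> (translation ^^ residue_nat k))"

definition phi :: "nat \<Rightarrow> complex ^ 'p::prime_card mod_ring" where
  "phi i = axis (of_nat i) 1 - axis (of_nat (CARD('p) - 1 - i)) 1"


subsection \<open>The binder and its parallel classes\<close>

definition vertical_line :: "'p::prime_card mod_ring \<Rightarrow> ('p mod_ring \<times> 'p mod_ring) set" where
  "vertical_line k = {(k, \<kappa>) | \<kappa>. True}"

definition sloped_line ::
    "'p::prime_card mod_ring \<Rightarrow> 'p mod_ring \<Rightarrow> ('p mod_ring \<times> 'p mod_ring) set" where
  "sloped_line a b = {(k, a * k + b) | k. True}"

definition binder_G :: "('p::prime_card mod_ring \<times> 'p mod_ring) set set" where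
  "binder_G = {vertical_line k | k. True} \<union> {sloped_line a b | a b. True}"

definition parallel_classes :: "('p::prime_card mod_ring \<times> 'p mod_ring) set set set" where
  "parallel_classes =
     insert {vertical_line k | k. True} {{sloped_line a b | b. True} | a. True}"

lemma Union_parallel_classes: "\<Union>parallel_classes = binder_G"
  unfolding parallel_classes_def binder_G_def by blast


subsection \<open>The vectors \<open>\<eta>\<close>\<close>

definition eta_vertical :: "'p::prime_card mod_ring \<Rightarrow> complex ^ 'p mod_ring" where
  "eta_vertical k = (\<chi> j. if k + of_nat ((CARD('p) - 1) div 2) = j then 1 else 0)"

definition eta_sloped ::
    "complex \<Rightarrow> 'p::prime_card mod_ring \<Rightarrow> 'p mod_ring \<Rightarrow> complex ^ 'p mod_ring" where
  "eta_sloped \<zeta> a b = (\<chi> j. complex_of_real (1 / sqrt (real CARD('p))) *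
     root_pow \<zeta> (of_nat ((CARD('p) + 1) div 2) * j * (a * j + 2 * b + a)))"

text \<open>The vector attached to a line, viewed as a set of points. The lemmas \<open>eta_vertical_line\<close> and
  \<open>eta_sloped_line\<close> show that the description is unambiguous on the binder.\<close>

definition eta ::
    "complex \<Rightarrow> ('p::prime_card mod_ring \<times> 'p mod_ring) set \<Rightarrow> complex ^ 'p mod_ring" where
  "eta \<zeta> \<beta> = (THE v. (\<exists>k. \<beta> = vertical_line k \<and> v = eta_vertical k) \<or>
                     (\<exists>a b. \<beta> = sloped_line a b \<and> v = eta_sloped \<zeta> a b))"

lemma vertical_line_inject: "vertical_line k = vertical_line l \<longleftrightarrow> k = l"
  by (auto simp: vertical_line_def)

lemma sloped_line_inject: "sloped_line a b = sloped_line c d \<longleftrightarrow> a = c \<and> b = d"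
proof
  assume eq: "sloped_line a b = sloped_line c d"
  have "(k, a * k + b) \<in> sloped_line c d" for k
    unfolding eq[symmetric] by (auto simp: sloped_line_def)
  then have *: "a * k + b = c * k + d" for k
    by (auto simp: sloped_line_def)
  show "a = c \<and> b = d"
    using *[of 0] *[of 1] by simp
qed simp

lemma vertical_line_neq_sloped_line: "vertical_line k \<noteq> sloped_line a b"
proof
  assume eq: "vertical_line k = sloped_line a b"
  have "(k + 1, a * (k + 1) + b) \<in> vertical_line k"
    unfolding eq by (auto simp: sloped_line_def)
  then show False
    by (auto simp: vertical_line_def)
qed

lemma eta_vertical_line: "eta \<zeta> (vertical_line k) = eta_vertical k"
  unfolding eta_def by (simp add: vertical_line_inject vertical_line_neq_sloped_line)

lemma eta_sloped_line: "eta \<zeta> (sloped_line a b) = eta_sloped \<zeta> a b"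
  unfolding eta_def
  by (simp add: sloped_line_inject vertical_line_neq_sloped_line[symmetric])

end

theory Submission
  imports Defs
begin

text \<open>
  Write \<open>ch x = \<zeta>\<^sup>x\<close> for the additive character of \<open>\<int>/p\<close>. The reflection \<open>i \<mapsto> -1-i\<close> exchanges the
  two basis vectors in \<open>\<phi>\<^sub>i\<close>, so a vector \<open>v\<close> is orthogonal to all \<open>M\<^sup>\<kappa> T\<^sup>k \<phi>\<^sub>i\<close> with
  \<open>(k, \<kappa>) \<in> \<beta>\<close> iff \<open>v (k+s) = ch (\<kappa> (2s+1)) v (k-1-s)\<close> for all residues \<open>s\<close> and \<open>(k, \<kappa>) \<in> \<beta>\<close>. On a
  vertical line this forces \<open>v\<close> to vanish off the fixed point of the reflection; on a sloped line
  any two coordinates of \<open>v\<close> are related by one of these equations, which \<open>\<eta>\<close> satisfies.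
  The inner products of the \<open>\<eta>\<close> are character sums: linear ones within a parallel class,
  quadratic Gauss sums of modulus \<open>\<surd>p\<close> between different classes of sloped lines.
\<close>

subsection \<open>The Hermitian inner product\<close>

lemma cinner_add_left: "cinner (u + u') v = cinner u v + cinner u' v"
  by (simp add: cinner_def distrib_right sum.distrib)

lemma cinner_scale_left: "cinner (c *s u) v = cnj c * cinner u v"
  by (simp add: cinner_def sum_distrib_left mult.assoc)

lemma cinner_scale_right: "cinner u (c *s v) = c * cinner u v"
  by (simp add: cinner_def sum_distrib_left mult_ac)

lemma cinner_zero_left [simp]: "cinner 0 v = 0"
  by (simp add: cinner_def)

lemma cinner_sum_right: "cinner u (\<Sum>i\<in>A. f i) = (\<Sum>i\<in>A. cinner u (f i))"
  by (induction A rule: infinite_finite_induct)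
    (simp_all add: cinner_def distrib_left sum.distrib)

lemma cnj_cinner: "cnj (cinner u v) = cinner v u"
  by (simp add: cinner_def mult.commute)

lemma cmod_cinner_commute: "cmod (cinner u v) = cmod (cinner v u)"
  by (metis cnj_cinner complex_mod_cnj)

text \<open>Orthogonality to a fixed vector passes to linear combinations, so only generators need
  testing.\<close>

lemma ccomplement_span: "ccomplement (vec.span S) = ccomplement S"
proof
  show "ccomplement (vec.span S) \<subseteq> ccomplement S"
    by (auto simp: ccomplement_def vec.span_base)
  show "ccomplement S \<subseteq> ccomplement (vec.span S)"
  proof
    fix v assume v: "v \<in> ccomplement S"
    have "cinner u v = 0" if "u \<in> vec.span S" for u
      using that
    proof (induction rule: vec.span_induct_alt)
      case (step c x y)
      then show ?case
        using v by (simp add: cinner_add_left cinner_scale_left ccomplement_def)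
    qed simp
    then show "v \<in> ccomplement (vec.span S)"
      by (simp add: ccomplement_def)
  qed
qed

text \<open>Pairing a vanishing combination with one of its vectors isolates that coefficient.
  Independence and the dimension count then give spanning.\<close>

lemma orthonormal_basisI:
  fixes B :: "(complex ^ 'n::finite) set"
  assumes B: "\<And>u v. u \<in> B \<Longrightarrow> v \<in> B \<Longrightarrow> cinner u v = (if u = v then 1 else 0)"
    and card: "card B = CARD('n)"
  shows "orthonormal_basis B"
proof -
  have fin: "finite B"
    by (rule card_ge_0_finite) (simp add: card)
  have indep: "vec.independent B"
  proof
    assume "vec.dependent B"
    then obtain c u where u: "u \<in> B" "c u \<noteq> 0" and 0: "(\<Sum>v\<in>B. c v *s v) = 0"
      using vec.dependent_finite[OF fin] by auto
    have "cinner u (\<Sum>v\<in>B. c v *s v) = (\<Sum>v\<in>B. if v = u then c v else 0)"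
      unfolding cinner_sum_right cinner_scale_right
      using u by (intro sum.cong) (auto simp: B)
    also have "\<dots> = c u"
      using u fin by simp
    finally show False
      using u 0 by (simp add: cinner_def)
  qed
  moreover have "vec.span B = UNIV"
    using vec.card_eq_dim[of B UNIV] fin indep card vec_dim_card[where ?'a = complex and ?'n = 'n]
    by (metis subset_UNIV top.extremum_unique)
  ultimately show ?thesis
    using B by (simp add: orthonormal_basis_def)
qed

subsection \<open>Residues modulo \<open>p\<close>\<close>

lemma residue_nat_less: "residue_nat (x :: 'p::prime_card mod_ring) < CARD('p)"
  unfolding residue_nat_def by transfer auto

lemma of_nat_residue_nat [simp]: "of_nat (residue_nat x) = (x :: 'p::prime_card mod_ring)"
  unfolding residue_nat_def by transfer auto

lemma residue_nat_of_nat: "residue_nat (of_nat n :: 'p::prime_card mod_ring) = n mod CARD('p)"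
proof -
  have "to_int_mod_ring (of_nat n :: 'p mod_ring) = int n mod int CARD('p)"
    by transfer auto
  then show ?thesis
    by (simp add: residue_nat_def nat_mod_distrib)
qed

lemma of_nat_card_mod_ring: "of_nat CARD('p) = (0 :: 'p::prime_card mod_ring)"
  by (metis mod_self of_nat_0 of_nat_residue_nat residue_nat_of_nat)

lemma of_nat_reflect:
  assumes "i < CARD('p::prime_card)"
  shows "of_nat (CARD('p) - 1 - i) = (- 1 - of_nat i :: 'p mod_ring)"
  using assms by (simp add: of_nat_diff of_nat_card_mod_ring)

lemma two_times_half:
  assumes "odd CARD('p::prime_card)"
  shows "2 * of_nat ((CARD('p) + 1) div 2) = (1 :: 'p mod_ring)"
proof -
  have "2 * of_nat ((CARD('p) + 1) div 2) = (of_nat (2 * ((CARD('p) + 1) div 2)) :: 'p mod_ring)"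
    by simp
  also have "2 * ((CARD('p) + 1) div 2) = CARD('p) + 1"
    using assms by simp
  finally show ?thesis
    by (simp add: of_nat_card_mod_ring)
qed

lemma two_times_reflection_center:
  assumes "odd CARD('p::prime_card)"
  shows "2 * of_nat ((CARD('p) - 1) div 2) = (- 1 :: 'p mod_ring)"
proof -
  have "2 * of_nat ((CARD('p) - 1) div 2) = (of_nat (2 * ((CARD('p) - 1) div 2)) :: 'p mod_ring)"
    by simp
  \<comment> \<open>The final \<open>- 0\<close> matches the shape of \<open>of_nat_reflect\<close>
    at index 0.\<close>
  also have "2 * ((CARD('p) - 1) div 2) = CARD('p) - 1 - 0"
    using assms by simp
  finally show ?thesis
    by (simp only: of_nat_reflect[OF zero_less_card_finite]) simp
qed

lemma mod_ring_two_neq_zero: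
  assumes "odd CARD('p::prime_card)"
  shows "(2 :: 'p mod_ring) \<noteq> 0"
  using two_times_half[OF assms] by auto

text \<open>Solutions of 2s = -1 are the fixed points of s \<mapsto> -1-s; as p is odd, 2 can be
  cancelled.\<close>

lemma reflection_center_unique:
  assumes "odd CARD('p::prime_card)" and "2 * s = (- 1 :: 'p mod_ring)"
  shows "s = of_nat ((CARD('p) - 1) div 2)"
  using two_times_reflection_center[OF assms(1)] mod_ring_two_neq_zero[OF assms(1)] assms(2)
  by (metis mult_left_cancel)

subsection \<open>The additive character\<close>

context
  fixes \<zeta> :: complex
  assumes zeta: "primitive_root_of_unity CARD('p::prime_card) \<zeta>"
begin

definition ch :: "'p mod_ring \<Rightarrow> complex" where
  "ch x = root_pow \<zeta> x"

text \<open>Since the p-th power of \<zeta> is 1, exponents matter only modulo p. The laws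
  \<open>ch_add\<close> and \<open>ch_power\<close> are instances at sums and products of
  representatives.\<close>

lemma ch_of_nat: "ch (of_nat n) = \<zeta> ^ n"
proof -
  have "\<zeta> ^ n = \<zeta> ^ (CARD('p) * (n div CARD('p)) + n mod CARD('p))"
    by simp
  also have "\<dots> = \<zeta> ^ (n mod CARD('p))"
    unfolding power_add power_mult
    using zeta by (simp add: primitive_root_of_unity_def)
  finally show ?thesis
    by (simp add: ch_def residue_nat_of_nat)
qed

lemma ch_0 [simp]: "ch 0 = 1"
  using ch_of_nat[of 0] by simp

lemma ch_add: "ch (x + y) = ch x * ch y"
  using ch_of_nat[of "residue_nat x + residue_nat y"] by (simp add: ch_def power_add)

lemma ch_power: "ch x ^ residue_nat y = ch (x * y)"
  using ch_of_nat[of "residue_nat x * residue_nat y"] by (simp add: ch_def power_mult)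

lemma ch_minus: "ch (- x) * ch x = 1"
  using ch_add[of "- x" x] by simp

lemma ch_neq_0 [simp]: "ch x \<noteq> 0"
  using ch_minus[of x] by auto

lemma cmod_ch [simp]: "cmod (ch x) = 1"
proof -
  have "cmod \<zeta> ^ CARD('p) = 1"
    using zeta by (metis norm_one norm_power primitive_root_of_unity_def)
  then have "cmod \<zeta> = 1"
    using power_eq_1_iff[of "cmod \<zeta>" "CARD('p)"] by simp
  then show ?thesis
    by (simp add: ch_def norm_power)
qed

lemma cnj_ch: "cnj (ch x) = ch (- x)"
proof -
  have "ch x * cnj (ch x) = 1"
    by (simp only: complex_norm_square[symmetric] cmod_ch) simp
  then have "ch x * cnj (ch x) = ch x * ch (- x)"
    using ch_minus[of x] by (simp add: mult.commute)
  then show ?thesis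
    by (metis ch_neq_0 mult_left_cancel)
qed

lemma ch_eq_1_iff: "ch x = 1 \<longleftrightarrow> x = 0"
proof
  assume "ch x = 1"
  then have "\<not> 0 < residue_nat x"
    using zeta residue_nat_less[of x] by (auto simp: ch_def primitive_root_of_unity_def)
  then show "x = 0"
    using of_nat_residue_nat[of x] by simp
qed simp

text \<open>Shifting the variable by 1 multiplies the sum by \<open>ch c\<close>, which differs from
  1 when c is nonzero.\<close>

lemma sum_ch: "(\<Sum>x\<in>UNIV. ch (c * x)) = (if c = 0 then of_nat CARD('p) else 0)"
proof (cases "c = 0")
  case False
  have "(\<Sum>x\<in>UNIV. ch (c * x)) = (\<Sum>x\<in>UNIV. ch (c * (x + 1)))"
    by (rule sum.reindex_bij_witness[where i = "\<lambda>x. x + 1" and j = "\<lambda>x. x - 1"]) auto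
  also have "\<dots> = (\<Sum>x\<in>UNIV. ch (c * x)) * ch c"
    by (simp add: distrib_left ch_add sum_distrib_right)
  finally show ?thesis
    using False ch_eq_1_iff[of c] by simp
qed simp

text \<open>In the squared modulus put x = y + d: the terms quadratic in y cancel, leaving over y a
  linear sum of frequency 2\<alpha>d, which survives only for d = 0.\<close>

lemma cmod_gauss_sum:
  assumes odd: "odd CARD('p)" and "\<alpha> \<noteq> 0"
  shows "cmod (\<Sum>x\<in>UNIV. ch (\<alpha> * x\<^sup>2 + \<beta> * x)) = sqrt (real CARD('p))"
proof -
  let ?q = "\<lambda>x. \<alpha> * x\<^sup>2 + \<beta> * x"
  let ?S = "\<Sum>x\<in>UNIV. ch (?q x)"
  have "?S * cnj ?S = (\<Sum>y\<in>UNIV. \<Sum>x\<in>UNIV. ch (?q x - ?q y))"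
    unfolding cnj_sum sum_product cnj_ch ch_add[symmetric] diff_conv_add_uminus[symmetric]
    by (rule sum.swap)
  also have "\<dots> = (\<Sum>y\<in>UNIV. \<Sum>d\<in>UNIV. ch (?q (y + d) - ?q y))"
  proof (rule sum.cong[OF refl])
    fix y
    show "(\<Sum>x\<in>UNIV. ch (?q x - ?q y)) = (\<Sum>d\<in>UNIV. ch (?q (y + d) - ?q y))"
      by (rule sum.reindex_bij_witness[where i = "\<lambda>d. y + d" and j = "\<lambda>x. x - y"]) auto
  qed
  also have "\<dots> = (\<Sum>d\<in>UNIV. ch (?q d) * (\<Sum>y\<in>UNIV. ch (2 * \<alpha> * d * y)))"
    by (subst sum.swap)
      (simp add: sum_distrib_left algebra_simps power2_eq_square flip: ch_add)
  also have "\<dots> = (\<Sum>d\<in>(UNIV :: 'p mod_ring set). if d = 0 then of_nat CARD('p) else 0)"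
    by (rule sum.cong[OF refl]) (auto simp: sum_ch \<open>\<alpha> \<noteq> 0\<close> mod_ring_two_neq_zero[OF odd])
  also have "\<dots> = of_nat CARD('p)"
    by simp
  finally have "complex_of_real ((cmod ?S)\<^sup>2) = complex_of_real (real CARD('p))"
    by (simp only: complex_norm_square of_real_of_nat_eq)
  then have "(cmod ?S)\<^sup>2 = real CARD('p)"
    by (simp only: of_real_eq_iff)
  from real_sqrt_unique[OF this norm_ge_zero] show ?thesis
    by (rule sym)
qed

subsection \<open>Inner products of the vectors \<open>\<eta>\<close>\<close>

lemma cinner_eta_vertical:
  "cinner (eta_vertical k) v = v $ (k + of_nat ((CARD('p) - 1) div 2))"
  for v :: "complex ^ 'p mod_ring"
proof -
  have "cinner (eta_vertical k) v =
      (\<Sum>j\<in>UNIV. if k + of_nat ((CARD('p) - 1) div 2) = j then v $ j else 0)"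
    unfolding cinner_def eta_vertical_def by (intro sum.cong) auto
  then show ?thesis
    by simp
qed

lemma cmod_eta_sloped: "cmod (eta_sloped \<zeta> a b $ (j :: 'p mod_ring)) = 1 / sqrt (real CARD('p))"
  by (simp add: eta_sloped_def norm_mult norm_divide flip: ch_def)

text \<open>The exponents combine into one polynomial: linear for equal slopes, otherwise quadratic,
  so that \<open>sum_ch\<close> or \<open>cmod_gauss_sum\<close> applies.\<close>

lemma cinner_eta_sloped:
  fixes a b c d :: "'p mod_ring"
  assumes odd: "odd CARD('p)"
  defines "h \<equiv> of_nat ((CARD('p) + 1) div 2)"
  shows "cinner (eta_sloped \<zeta> a b) (eta_sloped \<zeta> c d) =
    (\<Sum>j\<in>UNIV. ch (h * (c - a) * j\<^sup>2 + (d - b + h * (c - a)) * j)) / of_nat CARD('p)"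
proof -
  have h: "2 * h = 1"
    unfolding h_def by (rule two_times_half[OF odd])
  have exponent: "- (h * j * (a * j + 2 * b + a)) + h * j * (c * j + 2 * d + c) =
      h * (c - a) * j\<^sup>2 + (d - b + h * (c - a)) * j" for j
  proof -
    \<comment> \<open>Keeping \<open>2 * h\<close> unevaluated makes this a pure ring identity in
      h.\<close>
    have "- (h * j * (a * j + 2 * b + a)) + h * j * (c * j + 2 * d + c) =
        h * (c - a) * j\<^sup>2 + ((2 * h) * (d - b) + h * (c - a)) * j"
      by (simp add: algebra_simps power2_eq_square)
    then show ?thesis
      by (simp add: h)
  qed
  have s: "complex_of_real (sqrt (real CARD('p))) * complex_of_real (sqrt (real CARD('p))) =
      of_nat CARD('p)"
    by (simp flip: of_real_mult)
  have "cnj (eta_sloped \<zeta> a b $ j) * eta_sloped \<zeta> c d $ j =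
      ch (h * (c - a) * j\<^sup>2 + (d - b + h * (c - a)) * j) / of_nat CARD('p)" for j
    unfolding exponent[symmetric] ch_add eta_sloped_def h_def[symmetric] s[symmetric] ch_def[symmetric]
    by (simp add: cnj_ch)
  then show ?thesis
    by (simp add: cinner_def sum_divide_distrib)
qed

lemma parallel_class_cases:
  fixes P :: "('p mod_ring \<times> 'p mod_ring) set set"
  assumes "P \<in> parallel_classes" "\<beta> \<in> P"
  obtains k where "\<beta> = vertical_line k" "P = range vertical_line"
    | a b where "\<beta> = sloped_line a b" "P = range (sloped_line a)"
  using assms by (auto simp: parallel_classes_def full_SetCompr_eq)

lemma eta_orthonormal:
  fixes P :: "('p mod_ring \<times> 'p mod_ring) set set"
  assumes odd: "odd CARD('p)" and "P \<in> parallel_classes" "\<beta> \<in> P" "\<gamma> \<in> P"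
  shows "cinner (eta \<zeta> \<beta>) (eta \<zeta> \<gamma>) = (if \<beta> = \<gamma> then 1 else 0)"
proof -
  consider k l where "\<beta> = vertical_line k" "\<gamma> = vertical_line l"
    | a b d where "\<beta> = sloped_line a b" "\<gamma> = sloped_line a d"
    using parallel_class_cases[OF assms(2,3)] assms(4) by (metis rangeE)
  then show ?thesis
  proof cases
    case 1
    then show ?thesis
      by (auto simp: eta_vertical_line cinner_eta_vertical vertical_line_inject)
        (auto simp: eta_vertical_def)
  next
    case 2
    then show ?thesis
      by (auto simp: eta_sloped_line sloped_line_inject cinner_eta_sloped[OF odd] sum_ch)
  qed
qed

text \<open>A vertical vector picks out one coordinate of a sloped one, and all of these have the
  required modulus. Two different slopes give a Gauss sum divided by p.\<close>

lemma eta_unbiased: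
  fixes P Q :: "('p mod_ring \<times> 'p mod_ring) set set"
  assumes odd: "odd CARD('p)" and "P \<in> parallel_classes" "Q \<in> parallel_classes" "P \<noteq> Q"
    and "\<beta> \<in> P" "\<gamma> \<in> Q"
  shows "cmod (cinner (eta \<zeta> \<beta>) (eta \<zeta> \<gamma>)) = 1 / sqrt (real CARD('p))"
proof -
  consider k a b where "\<beta> = vertical_line k" "\<gamma> = sloped_line a b"
    | k a b where "\<gamma> = vertical_line k" "\<beta> = sloped_line a b"
    | a b c d where "a \<noteq> c" "\<beta> = sloped_line a b" "\<gamma> = sloped_line c d"
    using parallel_class_cases[OF assms(2,5)] parallel_class_cases[OF assms(3,6)] assms(4)
    by metis
  then show ?thesis
  proof cases
    case 1
    then show ?thesis
      by (simp add: eta_vertical_line eta_sloped_line cinner_eta_vertical cmod_eta_sloped)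
  next
    case 2
    then show ?thesis
      by (subst cmod_cinner_commute)
        (simp add: eta_vertical_line eta_sloped_line cinner_eta_vertical cmod_eta_sloped)
  next
    case 3
    \<comment> \<open>With different slopes this makes the leading coefficient nonzero.\<close>
    have "of_nat ((CARD('p) + 1) div 2) \<noteq> (0 :: 'p mod_ring)"
      using two_times_half[OF odd] by auto
    with 3 have "cmod (cinner (eta \<zeta> \<beta>) (eta \<zeta> \<gamma>)) = sqrt (real CARD('p)) / real CARD('p)"
      by (simp add: eta_sloped_line cinner_eta_sloped[OF odd] norm_divide cmod_gauss_sum[OF odd])
    then show ?thesis
      by (simp add: sqrt_divide_self_eq inverse_eq_divide)
  qed
qed

section \<open>Injectivity, counting of parallel classes, and the resulting bases\<close>

text \<open>Equal vectors have inner product 1. Across classes its modulus would be 1/sqrt p, which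
  is not 1; within a class orthonormality separates lines.\<close>

lemma inj_on_eta:
  assumes odd: "odd CARD('p)"
  shows "inj_on (eta \<zeta>) (binder_G :: ('p mod_ring \<times> 'p mod_ring) set set)"
proof (rule inj_onI)
  fix \<beta> \<gamma> :: "('p mod_ring \<times> 'p mod_ring) set"
  assume "\<beta> \<in> binder_G" "\<gamma> \<in> binder_G" and eq: "eta \<zeta> \<beta> = eta \<zeta> \<gamma>"
  then obtain P Q where PQ: "P \<in> parallel_classes" "\<beta> \<in> P" "Q \<in> parallel_classes" "\<gamma> \<in> Q"
    by (auto simp flip: Union_parallel_classes)
  have 1: "cinner (eta \<zeta> \<beta>) (eta \<zeta> \<gamma>) = 1"
    using eta_orthonormal[OF odd PQ(1,2,2)] eq by simp
  have "real CARD('p) \<noteq> 1"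
    using prime_card[where ?'a = 'p] by auto
  then have "P = Q"
    using eta_unbiased[OF odd PQ(1,3) _ PQ(2,4)] 1 by auto
  then show "\<beta> = \<gamma>"
    using eta_orthonormal[OF odd PQ(1,2), of \<gamma>] PQ(4) 1 by (simp split: if_splits)
qed

lemma card_parallel_class:
  fixes P :: "('p mod_ring \<times> 'p mod_ring) set set"
  assumes "P \<in> parallel_classes"
  shows "card P = CARD('p)"
proof -
  have "P = range vertical_line \<or> (\<exists>a. P = range (sloped_line a))"
    using assms by (auto simp: parallel_classes_def)
  then show ?thesis
    by (auto simp: card_image inj_on_def vertical_line_inject sloped_line_inject)
qed

lemma card_parallel_classes:
  "card (parallel_classes :: ('p mod_ring \<times> 'p mod_ring) set set set) = CARD('p) + 1"
proof -
  have eq: "parallel_classes =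
      insert (range vertical_line)
        (range (\<lambda>a. range (sloped_line a)) :: ('p mod_ring \<times> 'p mod_ring) set set set)"
    unfolding parallel_classes_def by blast
  have "inj (\<lambda>a :: 'p mod_ring. range (sloped_line a))"
  proof (rule injI)
    fix a c :: "'p mod_ring"
    assume "range (sloped_line a) = range (sloped_line c)"
    then have "sloped_line a 0 \<in> range (sloped_line c)"
      by blast
    then show "a = c"
      by (auto simp: sloped_line_inject)
  qed
  moreover have "range vertical_line \<noteq> range (sloped_line a)" for a :: "'p mod_ring"
    by (metis rangeE rangeI vertical_line_neq_sloped_line)
  ultimately show ?thesis
    unfolding eq by (subst card_insert_disjoint) (auto simp: card_image)
qed

lemma maximal_mubs_eta:
  assumes odd: "odd CARD('p)"
  shows "maximal_mubs ((\<lambda>P. eta \<zeta> ` P) `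
    (parallel_classes :: ('p mod_ring \<times> 'p mod_ring) set set set))"
  unfolding maximal_mubs_def
proof (intro conjI ballI impI)
  let ?C = "parallel_classes :: ('p mod_ring \<times> 'p mod_ring) set set set"
  \<comment> \<open>Injectivity on all lines makes the images of distinct classes distinct, so bases
    are counted by classes.\<close>
  have inj: "inj_on (eta \<zeta>) (\<Union> ?C)"
    using inj_on_eta[OF odd] by (simp add: Union_parallel_classes)
  show "card ((\<lambda>P. eta \<zeta> ` P) ` ?C) = CARD('p mod_ring) + 1"
    by (simp add: card_image inj_on_image[OF inj] card_parallel_classes)
  show "orthonormal_basis B" if B: "B \<in> (\<lambda>P. eta \<zeta> ` P) ` ?C" for B
  proof -
    obtain P where P: "P \<in> ?C" "B = eta \<zeta> ` P"
      using B by blast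
    have injP: "inj_on (eta \<zeta>) P"
      using inj P(1) by (meson Union_upper inj_on_subset)
    show ?thesis
      unfolding P(2)
      by (rule orthonormal_basisI)
        (auto simp: eta_orthonormal[OF odd P(1)] inj_on_eq_iff[OF injP] card_image[OF injP]
          card_parallel_class[OF P(1)])
  qed
  show "cmod (cinner u v) = 1 / sqrt (real CARD('p mod_ring))"
    if B: "B \<in> (\<lambda>P. eta \<zeta> ` P) ` ?C" and D: "D \<in> (\<lambda>P. eta \<zeta> ` P) ` ?C"
      and "B \<noteq> D" "u \<in> B" "v \<in> D" for B D u v
  proof -
    obtain P Q where "P \<in> ?C" "B = eta \<zeta> ` P" "Q \<in> ?C" "D = eta \<zeta> ` Q"
      using B D by blast
    with \<open>B \<noteq> D\<close> \<open>u \<in> B\<close> \<open>v \<in> D\<close> show ?thesis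
      using eta_unbiased[OF odd, of P Q] by auto
  qed
qed

subsection \<open>The complement of the shifted \<open>\<phi>\<^sub>i\<close>\<close>

lemma time_freq_shift_nth:
  "time_freq_shift \<zeta> (k, \<kappa>) v $ j = ch (\<kappa> * j) * v $ (j - k)"
proof -
  have M: "((modulation \<zeta> ^^ n) w) $ j = ch j ^ n * w $ j" for n w
    by (induction n) (auto simp: modulation_def ch_def)
  have T: "((translation ^^ n) w) $ i = w $ (i - of_nat n)"
    for n and w :: "complex ^ 'p mod_ring" and i
    by (induction n arbitrary: i) (auto simp: translation_def algebra_simps)
  show ?thesis
    by (simp add: time_freq_shift_def M T ch_power mult.commute)
qed

text \<open>The shifted \<open>phi i\<close> is supported on k + i and k - 1 - i, so orthogonality
  relates just these two coordinates of v.\<close>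

lemma cinner_shift_phi_eq_0_iff:
  fixes v :: "complex ^ 'p mod_ring"
  assumes "i < CARD('p)"
  shows "cinner (time_freq_shift \<zeta> (k, \<kappa>) (phi i)) v = 0 \<longleftrightarrow>
    v $ (k + of_nat i) = ch (\<kappa> * (2 * of_nat i + 1)) * v $ (k - 1 - of_nat i)"
proof -
  \<comment> \<open>A difference of two conditionals stays correct when both positions coincide and
    \<open>phi i\<close> is 0.\<close>
  have "cnj (time_freq_shift \<zeta> (k, \<kappa>) (phi i) $ j) * v $ j =
      (if j = k + of_nat i then ch (- (\<kappa> * j)) * v $ j else 0) -
      (if j = k - 1 - of_nat i then ch (- (\<kappa> * j)) * v $ j else 0)" for j
    unfolding time_freq_shift_nth phi_def of_nat_reflect[OF assms] complex_cnj_mult cnj_ch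
    by (auto simp: axis_def algebra_simps)
  then have "cinner (time_freq_shift \<zeta> (k, \<kappa>) (phi i)) v =
      ch (- (\<kappa> * (k + of_nat i))) * v $ (k + of_nat i) -
      ch (- (\<kappa> * (k - 1 - of_nat i))) * v $ (k - 1 - of_nat i)"
    by (simp add: cinner_def sum_subtractf)
  \<comment> \<open>This exposes a common nonzero phase, which then cancels.\<close>
  also have "- (\<kappa> * (k - 1 - of_nat i)) =
      - (\<kappa> * (k + of_nat i)) + \<kappa> * (2 * of_nat i + 1)"
    by (simp add: algebra_simps)
  finally show ?thesis
    unfolding ch_add by (simp add: mult.assoc)
qed

text \<open>The indices i cover half of the residues s. The equations at s and -1-s are equivalent,
  and at the fixed point the equation is trivial.\<close>

lemma ccomplement_shift_phi_iff:
  fixes v :: "complex ^ 'p mod_ring" and \<beta> :: "('p mod_ring \<times> 'p mod_ring) set"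
  assumes odd: "odd CARD('p)"
  shows "v \<in> ccomplement {time_freq_shift \<zeta> x (phi i) | x i. x \<in> \<beta> \<and> i \<le> (CARD('p) - 3) div 2} \<longleftrightarrow>
    (\<forall>(k, \<kappa>)\<in>\<beta>. \<forall>s. v $ (k + s) = ch (\<kappa> * (2 * s + 1)) * v $ (k - 1 - s))"
    (is "?L \<longleftrightarrow> ?R")
proof
  \<comment> \<open>This keeps the natural subtraction in the index bound from truncating.\<close>
  have p3: "CARD('p) \<ge> 3"
    using odd prime_ge_2_nat[OF prime_card[where ?'a = 'p]] by (cases "CARD('p) = 2") auto
  show ?L if R: ?R
    unfolding ccomplement_def
  proof (clarify)
    fix k \<kappa> and i :: nat
    assume "(k, \<kappa>) \<in> \<beta>" "i \<le> (CARD('p) - 3) div 2"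
    moreover from this p3 have "i < CARD('p)"
      by linarith
    ultimately show "cinner (time_freq_shift \<zeta> (k, \<kappa>) (phi i)) v = 0"
      using R by (auto simp: cinner_shift_phi_eq_0_iff)
  qed
  show ?R if L: ?L
  proof (clarify)
    fix k \<kappa> s :: "'p mod_ring"
    assume k: "(k, \<kappa>) \<in> \<beta>"
    have phi: "v $ (k + of_nat i) = ch (\<kappa> * (2 * of_nat i + 1)) * v $ (k - 1 - of_nat i)"
      if "i \<le> (CARD('p) - 3) div 2" for i
    proof -
      have "i < CARD('p)"
        using that p3 by linarith
      moreover have "cinner (time_freq_shift \<zeta> (k, \<kappa>) (phi i)) v = 0"
        using L k that unfolding ccomplement_def by blast
      ultimately show ?thesis
        by (simp add: cinner_shift_phi_eq_0_iff)
    qed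
    define n where "n = residue_nat s"
    have n: "of_nat n = s" "n < CARD('p)"
      by (simp_all add: n_def residue_nat_less)
    consider "n \<le> (CARD('p) - 3) div 2" | "n = (CARD('p) - 1) div 2"
      | "CARD('p) - 1 - n \<le> (CARD('p) - 3) div 2"
      using odd p3 by (elim oddE) (simp, linarith)
    then show "v $ (k + s) = ch (\<kappa> * (2 * s + 1)) * v $ (k - 1 - s)"
    proof cases
      case 1
      then show ?thesis
        using phi n by auto
    next
      case 2
      then have "2 * s = - 1"
        using two_times_reflection_center[OF odd] n by simp
      then have "2 * s + 1 = 0" "k - 1 - s = k + s"
        by (simp_all add: algebra_simps eq_neg_iff_add_eq_0)
      then show ?thesis
        by (simp only: mult_zero_right ch_0 mult_1)
    next
      case 3
      \<comment> \<open>This is the equation at the reflected index; inverting its phase gives the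
        one at s.\<close>
      have "v $ (k - 1 - s) = ch (- (\<kappa> * (2 * s + 1))) * v $ (k + s)"
        using phi[OF 3] unfolding of_nat_reflect[OF n(2)] n(1) by (simp add: algebra_simps)
      then have "ch (\<kappa> * (2 * s + 1)) * v $ (k - 1 - s) =
          (ch (- (\<kappa> * (2 * s + 1))) * ch (\<kappa> * (2 * s + 1))) * v $ (k + s)"
        by (simp only: mult_ac)
      then show ?thesis
        by (simp only: ch_minus mult_1)
    qed
  qed
qed

section \<open>Solving the reflection equations on each kind of line\<close>

text \<open>Here \<kappa> varies freely while the two coordinates stay fixed, so both vanish unless
  2s + 1 = 0; only the coordinate at the fixed point survives.\<close>

lemma span_eta_vertical:
  fixes k :: "'p mod_ring"
  assumes odd: "odd CARD('p)"
  shows "v \<in> vec.span {eta_vertical k} \<longleftrightarrow>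
    (\<forall>\<kappa> s. v $ (k + s) = ch (\<kappa> * (2 * s + 1)) * v $ (k - 1 - s))"
    (is "_ \<longleftrightarrow> ?R")
proof
  define m :: "'p mod_ring" where "m = of_nat ((CARD('p) - 1) div 2)"
  have m: "2 * m = - 1"
    unfolding m_def by (rule two_times_reflection_center[OF odd])
  have m_unique: "s = m" if "2 * s = - 1" for s
    unfolding m_def by (rule reflection_center_unique[OF odd that])
  have eta: "eta_vertical k $ j = (if j = k + m then 1 else 0)" for j
    by (auto simp: eta_vertical_def m_def)
  have refl_m: "- 1 - m = m"
    unfolding m[symmetric] by (simp only: mult_2 add_diff_cancel)
  have refl: "k - 1 - s = k + m \<longleftrightarrow> s = m" for s
  proof
    assume eq: "k - 1 - s = k + m"
    have "s = k - 1 - (k - 1 - s)"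
      by simp
    also have "\<dots> = - 1 - m"
      unfolding eq by simp
    finally show "s = m"
      by (simp only: refl_m)
  next
    assume "s = m"
    then have "k - 1 - s = k + (- 1 - m)"
      by simp
    then show "k - 1 - s = k + m"
      by (simp only: refl_m)
  qed
  show ?R if v: "v \<in> vec.span {eta_vertical k}"
  proof -
    obtain c where v: "v = c *s eta_vertical k"
      using v by (auto simp: vec.span_singleton)
    have "2 * m + 1 = 0"
      using m by simp
    then show ?thesis
      unfolding v by (auto simp: eta refl)
  qed
  show "v \<in> vec.span {eta_vertical k}" if R: ?R
  proof -
    have 0: "v $ (k + s) = 0" if "s \<noteq> m" for s
    proof -
      have "2 * s + 1 \<noteq> 0"
        using that m_unique by (auto simp: eq_neg_iff_add_eq_0)
      \<comment> \<open>The choices \<kappa> = 0 and \<kappa> = 1/(2s+1) give the same coordinates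
        the phases 1 and \<open>ch 1\<close>, which differ.\<close>
      then have "ch 1 * v $ (k - 1 - s) = v $ (k - 1 - s)"
        using R[rule_format, of s 0] R[rule_format, of s "1 / (2 * s + 1)"] by simp
      then have "v $ (k - 1 - s) = 0"
        using ch_eq_1_iff[of 1] by simp
      then show ?thesis
        using R[rule_format, of s 0] by simp
    qed
    have "v = v $ (k + m) *s eta_vertical k"
      unfolding vec_eq_iff
    proof
      fix j
      show "v $ j = (v $ (k + m) *s eta_vertical k) $ j"
        using 0[of "j - k"] by (cases "j = k + m") (auto simp: eta algebra_simps)
    qed
    then show ?thesis
      by (metis rangeI vec.span_singleton)
  qed
qed

text \<open>The equations determine every coordinate from the one at 0, so solutions form at most a
  line; \<open>eta_sloped\<close> is a nonzero solution.\<close>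

lemma span_eta_sloped:
  fixes a b :: "'p mod_ring"
  assumes odd: "odd CARD('p)"
  shows "v \<in> vec.span {eta_sloped \<zeta> a b} \<longleftrightarrow>
    (\<forall>k s. v $ (k + s) = ch ((a * k + b) * (2 * s + 1)) * v $ (k - 1 - s))"
    (is "_ \<longleftrightarrow> ?R v")
proof
  define h :: "'p mod_ring" where "h = of_nat ((CARD('p) + 1) div 2)"
  have h: "2 * h = 1"
    unfolding h_def by (rule two_times_half[OF odd])
  let ?eta = "eta_sloped \<zeta> a b"
  have R_eta: "?R ?eta"
  proof (intro allI)
    fix k s
    let ?q = "\<lambda>j. h * j * (a * j + 2 * b + a)"
    have "?q (k + s) - ?q (k - 1 - s) = (2 * h) * ((a * k + b) * (2 * s + 1))"
      by (simp add: algebra_simps)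
    then have "?q (k + s) = (a * k + b) * (2 * s + 1) + ?q (k - 1 - s)"
      by (simp add: h diff_eq_eq)
    then show "?eta $ (k + s) = ch ((a * k + b) * (2 * s + 1)) * ?eta $ (k - 1 - s)"
      unfolding eta_sloped_def h_def[symmetric] ch_def[symmetric] by (simp add: ch_add)
  qed
  show "?R v" if "v \<in> vec.span {?eta}"
    using that R_eta by (auto simp: vec.span_singleton)
  show "v \<in> vec.span {?eta}" if R: "?R v"
  proof -
    \<comment> \<open>The factor c is chosen before w, so v and \<open>?eta\<close> share
      it.\<close>
    have from_0: "\<exists>c. \<forall>w. ?R w \<longrightarrow> w $ j = c * w $ 0" for j
    proof -
      \<comment> \<open>The witnesses k = h(j+1) and s = h(j-1) solve k + s = j and k - 1 - s =
        0.\<close>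
      have "h * (j + 1) + h * (j - 1) = (2 * h) * j" "h * (j + 1) - 1 - h * (j - 1) = 2 * h - 1"
        by (simp_all add: algebra_simps)
      then have "h * (j + 1) + h * (j - 1) = j" "h * (j + 1) - 1 - h * (j - 1) = 0"
        by (simp_all add: h)
      then show ?thesis
        by metis
    qed
    have eta0: "?eta $ 0 \<noteq> 0"
      by (simp add: eta_sloped_def flip: ch_def)
    have "v = (v $ 0 / ?eta $ 0) *s ?eta"
      unfolding vec_eq_iff
    proof
      fix j
      obtain c where c: "v $ j = c * v $ 0" "?eta $ j = c * ?eta $ 0"
        using from_0[of j] R R_eta by blast
      show "v $ j = ((v $ 0 / ?eta $ 0) *s ?eta) $ j"
        using eta0 by (simp add: c)
    qed
    then show ?thesis
      by (metis rangeI vec.span_singleton)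
  qed
qed

text \<open>Both sides are the solution set of the same reflection equations along \<beta>.\<close>

lemma span_eta:
  fixes \<beta> :: "('p mod_ring \<times> 'p mod_ring) set"
  assumes odd: "odd CARD('p)" and "\<beta> \<in> binder_G"
  shows "vec.span {eta \<zeta> \<beta>} =
    ccomplement (vec.span {time_freq_shift \<zeta> x (phi i) | x i. x \<in> \<beta> \<and> i \<le> (CARD('p) - 3) div 2})"
proof -
  consider k where "\<beta> = vertical_line k" | a b where "\<beta> = sloped_line a b"
    using assms(2) by (auto simp: binder_G_def)
  then have "v \<in> vec.span {eta \<zeta> \<beta>} \<longleftrightarrow>
    (\<forall>(k, \<kappa>)\<in>\<beta>. \<forall>s. v $ (k + s) = ch (\<kappa> * (2 * s + 1)) * v $ (k - 1 - s))" for v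
  proof cases
    case 1
    then show ?thesis
      unfolding 1 eta_vertical_line span_eta_vertical[OF odd] by (auto simp: vertical_line_def)
  next
    case 2
    then show ?thesis
      unfolding 2 eta_sloped_line span_eta_sloped[OF odd] by (auto simp: sloped_line_def)
  qed
  then show ?thesis
    unfolding ccomplement_span set_eq_iff ccomplement_shift_phi_iff[OF odd] by blast
qed

end

theorem theorem7p2:
  fixes \<zeta> :: complex
  assumes p_odd: "odd CARD('p::prime_card)"
    and zeta: "primitive_root_of_unity CARD('p) \<zeta>"
  shows "inj_on (eta \<zeta>) (binder_G :: ('p mod_ring \<times> 'p mod_ring) set set) \<and>
         maximal_mubs
           ((\<lambda>P. eta \<zeta> ` P) ` (parallel_classes :: ('p mod_ring \<times> 'p mod_ring) set set set)) \<and>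
         (\<forall>\<beta> \<in> (binder_G :: ('p mod_ring \<times> 'p mod_ring) set set).
            vec.span {eta \<zeta> \<beta>} =
            ccomplement (vec.span {time_freq_shift \<zeta> x (phi i) | x i.
                           x \<in> \<beta> \<and> i \<le> (CARD('p) - 3) div 2}))"
  using inj_on_eta[OF zeta p_odd] maximal_mubs_eta[OF zeta p_odd] span_eta[OF zeta p_odd]
  by blast

end
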